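(* Let $G$ be a connected bipartite graph. Then for every $A\in\ddot{\mathcal{S}}(G)$, the largest eigenvalue of $A$ is simple (has multiplicity one).
   Context: For a simple finite graph $G$ on $n$ vertices, $\ddot{\mathcal{S}}(G)$ is the set of discrete Schrödinger operators of $G$: $n\times n$ real symmetric matrices (indexed by $V(G)$) whose off-diagonal $i,j$-entry is negative if $\{i,j\}$ is an edge and zero if it is not; diagonal entries are arbitrary real numbers. *)

theory Defs
  imports
    "Graph_Theory.Digraph_Component"
    "Jordan_Normal_Form.Spectral_Radius"
begin

text \<open>
  A simple finite graph is an instance of the locale \<^locale>\<open>graph\<close>: a finite digraph with
  symmetric arc relation, without loops and parallel arcs.  The edge \<open>{u, v}\<close> is the pair of
  arcs between \<open>u\<close> and \<open>v\<close>, so \<open>{u, v}\<close> is an edge iff \<open>(u, v) \<in> arcs_ends G\<close>.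
\<close>

text \<open>The parts may be empty; this matters only for graphs without edges.\<close>

definition bipartite :: "('a, 'b) pre_digraph \<Rightarrow> bool" where
  "bipartite G \<longleftrightarrow>
    (\<exists>X Y. verts G = X \<union> Y \<and> X \<inter> Y = {} \<and>
      (\<forall>(u, v) \<in> arcs_ends G. u \<in> X \<and> v \<in> Y \<or> u \<in> Y \<and> v \<in> X))"

text \<open>
  Matrices are indexed by \<open>0, \<dots>, n - 1\<close>, so indexing by the vertex set takes a list \<open>vs\<close> that
  enumerates the vertices without repetition: row and column \<open>i\<close> belong to the vertex \<open>vs ! i\<close>.
\<close>

definition vertex_enumeration :: "('a, 'b) pre_digraph \<Rightarrow> 'a list \<Rightarrow> bool" where
  "vertex_enumeration G vs \<longleftrightarrow> distinct vs \<and> set vs = verts G"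

definition schroedinger_operators :: "('a, 'b) pre_digraph \<Rightarrow> 'a list \<Rightarrow> real mat set" where
  "schroedinger_operators G vs =
    {A \<in> carrier_mat (length vs) (length vs).
      transpose_mat A = A \<and>
      (\<forall>i < length vs. \<forall>j < length vs. i \<noteq> j \<longrightarrow>
        (if (vs ! i, vs ! j) \<in> arcs_ends G then A $$ (i, j) < 0 else A $$ (i, j) = 0))}"

text \<open>
  Multiplicity is algebraic multiplicity; for the symmetric matrices considered here it
  coincides with the dimension of the eigenspace.
\<close>

definition simple_eigenvalue :: "'a :: field mat \<Rightarrow> 'a \<Rightarrow> bool" where
  "simple_eigenvalue A k \<longleftrightarrow> eigenvalue A k \<and> order k (char_poly A) = 1"

end

theory Submission
  imports Defs "HOL-Analysis.Function_Topology"
begin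

text \<open>
  The idea is that of Perron and Frobenius.  A bipartition \<open>X, Y\<close> turns \<open>A\<close> into a matrix with
  nonnegative off-diagonal entries: conjugate by the diagonal sign matrix that is \<open>1\<close> on \<open>X\<close> and
  \<open>-1\<close> on \<open>Y\<close>.  Every edge joins \<open>X\<close> to \<open>Y\<close>, so every nonzero off-diagonal entry changes sign.

  The largest eigenvalue \<open>m\<close> is the maximum of the Rayleigh quotient, so \<open>M = A - m I\<close> is negative
  semidefinite, and its kernel, the eigenspace of \<open>m\<close>, consists of exactly those vectors on which
  its quadratic form vanishes (\<open>Max_spectrum_symmetric\<close>,
  \<open>negative_semidefinite_isotropic_imp_kernel\<close>).  Let \<open>x\<close> be in the kernel, and replace each entry
  by its absolute value, times the sign of its vertex.  This cannot decrease the form, so the new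
  vector is in the kernel as well.  If \<open>x\<close> vanishes at a vertex, the kernel equation there equates
  to zero a sum, with positive coefficients, of the values of \<open>\<bar>x\<bar>\<close> at the neighbours; so
  \<open>x\<close> vanishes at all neighbours (\<open>zero_entry_propagates\<close>) and, the graph being connected,
  everywhere.  Nonzero eigenvectors thus have no zero entry.  Of two eigenvectors, some
  nontrivial linear combination has a zero entry at index \<open>0\<close>, so it vanishes, and the eigenspace is a line.

  For a symmetric matrix an eigenvalue whose eigenspace is a line is a simple root of the
  characteristic polynomial (\<open>order_char_poly_symmetric\<close>).
\<close>

section \<open>Quadratic forms\<close>

lemma quadratic_form_sum:
  fixes A :: "real mat"
  assumes "A \<in> carrier_mat n n" "x \<in> carrier_vec n" "y \<in> carrier_vec n"
  shows "x \<bullet> (A *\<^sub>v y) = (\<Sum>i<n. \<Sum>j<n. A $$ (i, j) * x $ i * y $ j)"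
proof -
  have "x \<bullet> (A *\<^sub>v y) = (\<Sum>i<n. x $ i * (\<Sum>j<n. A $$ (i, j) * y $ j))"
    using assms by (auto simp: scalar_prod_def atLeast0LessThan intro!: sum.cong)
  also have "\<dots> = (\<Sum>i<n. \<Sum>j<n. A $$ (i, j) * x $ i * y $ j)"
    by (simp add: sum_distrib_left mult_ac)
  finally show ?thesis .
qed

lemma symmetric_scalar_prod:
  fixes A :: "real mat"
  assumes A: "A \<in> carrier_mat n n" "transpose_mat A = A"
    and x: "x \<in> carrier_vec n" and y: "y \<in> carrier_vec n"
  shows "x \<bullet> (A *\<^sub>v y) = y \<bullet> (A *\<^sub>v x)"
proof -
  have sym: "A $$ (i, j) = A $$ (j, i)" if "i < n" "j < n" for i j
    using index_transpose_mat(1)[of i A j] A that by simp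
  show ?thesis
    unfolding quadratic_form_sum[OF A(1) x y] quadratic_form_sum[OF A(1) y x]
    by (subst sum.swap) (auto simp: sym intro!: sum.cong)
qed

lemma real_scalar_prod_self:
  fixes x :: "real vec"
  assumes "x \<in> carrier_vec n"
  shows "x \<bullet> x \<ge> 0" and "x \<bullet> x = 0 \<longleftrightarrow> x = 0\<^sub>v n"
  using conjugate_square_ge_0_vec[of x] conjugate_square_eq_0_vec[OF assms] by simp_all

text \<open>
  The quadratic form is continuous on the unit sphere, hence attains its maximum there; by
  homogeneity this bounds the form everywhere.  Compactness is taken from Tychonoff's theorem:
  vectors are represented by functions on all of \<open>nat\<close> with values in \<open>[-1, 1]\<close>, of which only the
  first \<open>n\<close> values enter the constraint and the form.
\<close>

lemma Rayleigh_maximizer: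
  fixes A :: "real mat"
  assumes A: "A \<in> carrier_mat n n" and n: "n > 0"
  obtains x where "x \<in> carrier_vec n" "x \<bullet> x = 1"
    "\<And>y. y \<in> carrier_vec n \<Longrightarrow> y \<bullet> (A *\<^sub>v y) \<le> (x \<bullet> (A *\<^sub>v x)) * (y \<bullet> y)"
proof -
  define q where "q f = (\<Sum>i<n. \<Sum>j<n. A $$ (i, j) * f i * f j)" for f :: "nat \<Rightarrow> real"
  define B where "B = PiE (UNIV :: nat set) (\<lambda>_. {-1..1 :: real})"
  define S where "S = B \<inter> {f. (\<Sum>i<n. f i * f i) = 1}"
  have "compact B"
    unfolding B_def
    using compactin_PiE[of "\<lambda>_. euclidean" UNIV "\<lambda>_::nat. {-1..1 :: real}"]
    by (simp add: euclidean_product_topology)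
  moreover have "closed {f :: nat \<Rightarrow> real. (\<Sum>i<n. f i * f i) = 1}"
    by (intro closed_Collect_eq continuous_intros continuous_on_product_coordinates)
  ultimately have "compact S"
    unfolding S_def by (rule compact_Int_closed)
  have "(\<lambda>i. if i = 0 then 1 else 0) \<in> S"
    using n by (auto simp: S_def B_def if_distrib[of "\<lambda>a. a * _"] sum.If_cases cong: if_cong)
  hence "S \<noteq> {}" by auto
  have "continuous_on S q"
    unfolding q_def
    by (intro continuous_intros continuous_on_subset[OF continuous_on_product_coordinates]) auto
  from continuous_attains_sup[OF \<open>compact S\<close> \<open>S \<noteq> {}\<close> this]
  obtain f where f: "f \<in> S" and max: "\<And>g. g \<in> S \<Longrightarrow> q g \<le> q f" by blast
  define x where "x = vec n f"
  have x: "x \<in> carrier_vec n" by (simp add: x_def)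
  have xx: "x \<bullet> x = 1"
    using f by (simp add: x_def S_def scalar_prod_def atLeast0LessThan)
  have qx: "x \<bullet> (A *\<^sub>v x) = q f"
    unfolding quadratic_form_sum[OF A x x] q_def by (simp add: x_def)
  have "y \<bullet> (A *\<^sub>v y) \<le> q f * (y \<bullet> y)" if y: "y \<in> carrier_vec n" for y
  proof (cases "y \<bullet> y = 0")
    case True
    hence "y = 0\<^sub>v n" using real_scalar_prod_self(2)[OF y] by simp
    thus ?thesis using A by simp
  next
    case False
    define c where "c = sqrt (y \<bullet> y)"
    have yy: "y \<bullet> y = (\<Sum>i<n. y $ i * y $ i)"
      using y by (simp add: scalar_prod_def atLeast0LessThan)
    have "y \<bullet> y \<ge> 0" by (rule real_scalar_prod_self[OF y])
    with False have c: "c > 0" "c * c = y \<bullet> y" by (auto simp: c_def)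
    define g where "g i = (if i < n then y $ i / c else 0)" for i
    have norm: "(\<Sum>i<n. g i * g i) = 1"
    proof -
      have "(\<Sum>i<n. g i * g i) = (\<Sum>i<n. y $ i * y $ i) / (c * c)"
        by (simp add: g_def sum_divide_distrib)
      thus ?thesis using c False by (simp add: yy)
    qed
    have "\<bar>g i\<bar> \<le> 1" for i
    proof (cases "i < n")
      case True
      have "g i * g i \<le> (\<Sum>i<n. g i * g i)"
        using True by (intro member_le_sum) auto
      with norm show ?thesis by (simp add: abs_square_le_1[symmetric] power2_eq_square)
    qed (simp add: g_def)
    hence "g \<in> S"
      using norm by (auto simp: S_def B_def abs_le_iff)
    hence "q g \<le> q f" by (rule max)
    moreover have "y \<bullet> (A *\<^sub>v y) = (y \<bullet> y) * q g"
    proof -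
      have "q g = (\<Sum>i<n. \<Sum>j<n. A $$ (i, j) * y $ i * y $ j) / (c * c)"
        unfolding q_def g_def by (simp add: sum_divide_distrib)
      thus ?thesis using c False by (simp add: quadratic_form_sum[OF A y y])
    qed
    ultimately show ?thesis
      using mult_left_mono[OF _ \<open>y \<bullet> y \<ge> 0\<close>] by (simp add: mult.commute)
  qed
  with x xx qx that show thesis by metis
qed

text \<open>
  At \<open>x\<close> the form attains its maximum \<open>0\<close>, so its derivative \<open>2 M x\<close> vanishes.  Concretely, with
  \<open>r = M x\<close> the form at \<open>x + t r\<close> is \<open>2 t (r \<bullet> r) + t\<^sup>2 Q\<close>, which would be positive for small
  \<open>t > 0\<close> if \<open>r\<close> were nonzero.
\<close>

lemma negative_semidefinite_isotropic_imp_kernel: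
  fixes M :: "real mat"
  assumes M: "M \<in> carrier_mat n n" "transpose_mat M = M"
    and neg: "\<And>y. y \<in> carrier_vec n \<Longrightarrow> y \<bullet> (M *\<^sub>v y) \<le> 0"
    and x: "x \<in> carrier_vec n" "x \<bullet> (M *\<^sub>v x) = 0"
  shows "M *\<^sub>v x = 0\<^sub>v n"
proof -
  define r where "r = M *\<^sub>v x"
  have r: "r \<in> carrier_vec n" using M x by (simp add: r_def)
  define Q where "Q = r \<bullet> (M *\<^sub>v r)"
  have s0: "r \<bullet> r \<ge> 0" by (rule real_scalar_prod_self[OF r])
  \<comment> \<open>small enough that the quadratic term cannot outweigh the linear one\<close>
  define t where "t = r \<bullet> r / (\<bar>Q\<bar> + 1)"
  have expand: "(x + t \<cdot>\<^sub>v r) \<bullet> (M *\<^sub>v (x + t \<cdot>\<^sub>v r)) = 2 * t * (r \<bullet> r) + t * t * Q"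
  proof -
    have Mr: "M *\<^sub>v r \<in> carrier_vec n" using M r by simp
    have "M *\<^sub>v (x + t \<cdot>\<^sub>v r) = r + t \<cdot>\<^sub>v (M *\<^sub>v r)"
      using M x r by (simp add: r_def mult_add_distrib_mat_vec mult_mat_vec)
    moreover have "(x + t \<cdot>\<^sub>v r) \<bullet> (r + t \<cdot>\<^sub>v (M *\<^sub>v r)) =
        x \<bullet> r + t * (x \<bullet> (M *\<^sub>v r)) + t * (r \<bullet> r) + t * t * (r \<bullet> (M *\<^sub>v r))"
      using x r Mr
      by (simp add: add_scalar_prod_distrib[of _ n] scalar_prod_add_distrib[of _ n] algebra_simps)
    moreover have "x \<bullet> r = 0" using x by (simp add: r_def)
    moreover have "x \<bullet> (M *\<^sub>v r) = r \<bullet> r"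
      using symmetric_scalar_prod[OF M x(1) r] by (simp add: r_def)
    ultimately show ?thesis by (simp add: Q_def)
  qed
  have le: "2 * t * (r \<bullet> r) + t * t * Q \<le> 0"
    using neg[of "x + t \<cdot>\<^sub>v r"] x r by (simp add: expand)
  have "r \<bullet> r = 0"
  proof (rule ccontr)
    assume "r \<bullet> r \<noteq> 0"
    with s0 have s: "r \<bullet> r > 0" by simp
    hence t: "t > 0" by (simp add: t_def)
    have "t * (\<bar>Q\<bar> + 1) = r \<bullet> r" by (simp add: t_def)
    moreover have "t * (2 * (r \<bullet> r) + t * Q) \<le> 0" using le by (simp add: algebra_simps)
    hence "2 * (r \<bullet> r) + t * Q \<le> 0" using t by (simp add: mult_le_0_iff)
    moreover have "t * Q \<ge> - (t * \<bar>Q\<bar>)"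
      using t by (metis abs_ge_minus_self abs_mult abs_of_pos minus_le_iff)
    ultimately show False using s t by (simp add: algebra_simps)
  qed
  thus ?thesis using real_scalar_prod_self(2)[OF r] by (simp add: r_def)
qed

section \<open>The largest eigenvalue of a symmetric matrix\<close>

lemma char_matrix_mult_vec:
  fixes A :: "'a :: field mat"
  assumes "A \<in> carrier_mat n n" "x \<in> carrier_vec n"
  shows "char_matrix A k *\<^sub>v x = A *\<^sub>v x - k \<cdot>\<^sub>v x"
  using assms by (intro eq_vecI) (auto simp: char_matrix_def add_scalar_prod_distrib[of _ n])

lemma quadratic_form_char_matrix:
  fixes A :: "real mat"
  assumes A: "A \<in> carrier_mat n n" and y: "y \<in> carrier_vec n"
  shows "y \<bullet> (char_matrix A k *\<^sub>v y) = y \<bullet> (A *\<^sub>v y) - k * (y \<bullet> y)"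
  unfolding char_matrix_mult_vec[OF A y]
  using A y by (subst scalar_prod_minus_distrib[of _ n]) auto

lemma transpose_char_matrix:
  fixes A :: "'a :: field mat"
  assumes "A \<in> carrier_mat n n" "transpose_mat A = A"
  shows "transpose_mat (char_matrix A k) = char_matrix A k"
proof -
  have sym: "A $$ (i, j) = A $$ (j, i)" if "i < n" "j < n" for i j
    using index_transpose_mat(1)[of i A j] assms that by simp
  show ?thesis
    using assms(1) by (intro eq_matI) (auto simp: char_matrix_def intro: sym)
qed

text \<open>
  A maximizer \<open>x\<close> of the Rayleigh quotient is an eigenvector, since the form of \<open>A - m I\<close> is
  nonpositive and vanishes at \<open>x\<close>.  Every eigenvalue is a Rayleigh quotient, so none exceeds \<open>m\<close>.
  In particular, real eigenvalues exist, so that the maximum is meaningful.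
\<close>

lemma Max_spectrum_symmetric:
  fixes A :: "real mat"
  assumes A: "A \<in> carrier_mat n n" "transpose_mat A = A" and n: "n > 0"
  shows "eigenvalue A (Max (spectrum A))"
    and "\<And>y. y \<in> carrier_vec n \<Longrightarrow> y \<bullet> (char_matrix A (Max (spectrum A)) *\<^sub>v y) \<le> 0"
proof -
  obtain x where x: "x \<in> carrier_vec n" "x \<bullet> x = 1"
    and max: "\<And>y. y \<in> carrier_vec n \<Longrightarrow> y \<bullet> (A *\<^sub>v y) \<le> (x \<bullet> (A *\<^sub>v x)) * (y \<bullet> y)"
    using Rayleigh_maximizer[OF A(1) n] by blast
  define m where "m = x \<bullet> (A *\<^sub>v x)"
  have neg: "y \<bullet> (char_matrix A m *\<^sub>v y) \<le> 0" if "y \<in> carrier_vec n" for y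
    using max[OF that] by (simp add: quadratic_form_char_matrix[OF A(1) that] m_def)
  have "char_matrix A m *\<^sub>v x = 0\<^sub>v n"
  proof (rule negative_semidefinite_isotropic_imp_kernel[OF _ _ neg x(1)])
    show "char_matrix A m \<in> carrier_mat n n" using A by simp
    show "transpose_mat (char_matrix A m) = char_matrix A m" by (rule transpose_char_matrix[OF A])
    show "x \<bullet> (char_matrix A m *\<^sub>v x) = 0"
      using x by (simp add: quadratic_form_char_matrix[OF A(1)] m_def)
  qed
  moreover have "x \<noteq> 0\<^sub>v n" using x by auto
  ultimately have ev: "eigenvalue A m"
    unfolding eigenvalue_def eigenvector_char_matrix[OF A(1)] using x by blast
  have "k \<le> m" if "eigenvalue A k" for k
  proof -
    obtain y where y: "y \<in> carrier_vec n" "y \<noteq> 0\<^sub>v n" "A *\<^sub>v y = k \<cdot>\<^sub>v y"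
      using \<open>eigenvalue A k\<close> A unfolding eigenvalue_def eigenvector_def by auto
    have "k * (y \<bullet> y) \<le> m * (y \<bullet> y)" using max[OF y(1)] y by (simp add: m_def)
    moreover have "y \<bullet> y > 0"
      using real_scalar_prod_self[OF y(1)] y(2) by linarith
    ultimately show ?thesis by simp
  qed
  hence Max: "Max (spectrum A) = m"
    using ev card_finite_spectrum(1)[OF A(1)] by (intro Max_eqI) (auto simp: spectrum_def)
  show "eigenvalue A (Max (spectrum A))" using ev by (simp add: Max)
  show "y \<bullet> (char_matrix A (Max (spectrum A)) *\<^sub>v y) \<le> 0" if "y \<in> carrier_vec n" for y
    using neg[OF that] by (simp add: Max)
qed

section \<open>Zeros of eigenvectors for the largest eigenvalue\<close>

text \<open>
  The Perron-Frobenius step.  The signs \<open>\<epsilon>\<close> make the off-diagonal entries of \<open>M\<close> nonnegative, so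
  the vector with entries \<open>\<epsilon> i * \<bar>x $ i\<bar>\<close> has at least the form value \<open>0\<close> of \<open>x\<close> and lies in the
  kernel too.  In row \<open>i\<close> of its kernel equation, multiplied by \<open>\<epsilon> i\<close>, the diagonal
  summand vanishes with \<open>x $ i\<close> and no other is negative, so each one vanishes.
\<close>

lemma zero_entry_propagates:
  fixes M :: "real mat" and \<epsilon> :: "nat \<Rightarrow> real"
  assumes M: "M \<in> carrier_mat n n" "transpose_mat M = M"
    and neg: "\<And>y. y \<in> carrier_vec n \<Longrightarrow> y \<bullet> (M *\<^sub>v y) \<le> 0"
    and \<epsilon>: "\<And>i. i < n \<Longrightarrow> \<bar>\<epsilon> i\<bar> = 1"
    and signs: "\<And>i j. i < n \<Longrightarrow> j < n \<Longrightarrow> i \<noteq> j \<Longrightarrow> \<epsilon> i * \<epsilon> j * M $$ (i, j) \<ge> 0"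
    and x: "x \<in> carrier_vec n" "M *\<^sub>v x = 0\<^sub>v n"
    and i: "i < n" "x $ i = 0"
    and j: "j < n" "M $$ (i, j) \<noteq> 0"
  shows "x $ j = 0"
proof -
  define y where "y = vec n (\<lambda>i. \<epsilon> i * \<bar>x $ i\<bar>)"
  have y: "y \<in> carrier_vec n" by (simp add: y_def)
  have \<epsilon>2: "\<epsilon> i * \<epsilon> i = 1" if "i < n" for i
    using \<epsilon>[OF that] by (metis abs_mult_self_eq mult_1)
  have "M $$ (k, l) * x $ k * x $ l \<le> M $$ (k, l) * y $ k * y $ l" if "k < n" "l < n" for k l
  proof (cases "k = l")
    case True
    have "y $ k * y $ k = x $ k * x $ k"
      using that \<epsilon>2[of k] by (simp add: y_def algebra_simps)
    thus ?thesis using True by (simp add: mult.assoc)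
  next
    case False
    have "M $$ (k, l) * x $ k * x $ l \<le> \<bar>M $$ (k, l)\<bar> * \<bar>x $ k\<bar> * \<bar>x $ l\<bar>"
      by (metis abs_ge_self abs_mult)
    also have "\<bar>M $$ (k, l)\<bar> = \<bar>\<epsilon> k * \<epsilon> l * M $$ (k, l)\<bar>"
      using \<epsilon> that by (simp add: abs_mult)
    also have "\<dots> = \<epsilon> k * \<epsilon> l * M $$ (k, l)" using signs[OF that False] by simp
    finally show ?thesis using that by (simp add: y_def mult_ac)
  qed
  hence "x \<bullet> (M *\<^sub>v x) \<le> y \<bullet> (M *\<^sub>v y)"
    unfolding quadratic_form_sum[OF M(1) x(1) x(1)] quadratic_form_sum[OF M(1) y y]
    by (intro sum_mono) auto
  moreover have "x \<bullet> (M *\<^sub>v x) = 0" using x by simp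
  ultimately have "y \<bullet> (M *\<^sub>v y) = 0" using neg[OF y] by simp
  from negative_semidefinite_isotropic_imp_kernel[OF M neg y this]
  have "M *\<^sub>v y = 0\<^sub>v n" .
  hence "(M *\<^sub>v y) $ i = 0" using i by simp
  hence "(\<Sum>l<n. M $$ (i, l) * y $ l) = 0"
    using M y i by (simp add: scalar_prod_def atLeast0LessThan)
  hence "\<epsilon> i * (\<Sum>l<n. M $$ (i, l) * y $ l) = 0" by simp
  hence sum0: "(\<Sum>l<n. \<epsilon> i * \<epsilon> l * M $$ (i, l) * \<bar>x $ l\<bar>) = 0"
    by (simp add: sum_distrib_left y_def mult_ac)
  have "\<epsilon> i * \<epsilon> l * M $$ (i, l) * \<bar>x $ l\<bar> \<ge> 0" if "l < n" for l
    using signs[OF i(1) that] i(2) by (cases "l = i") auto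
  with sum0 have "\<epsilon> i * \<epsilon> j * M $$ (i, j) * \<bar>x $ j\<bar> = 0"
    using j(1) by (subst (asm) sum_nonneg_eq_0_iff) auto
  moreover have "\<epsilon> i \<noteq> 0" "\<epsilon> j \<noteq> 0" using \<epsilon>[OF i(1)] \<epsilon>[OF j(1)] by auto
  ultimately show ?thesis using j by simp
qed

section \<open>Geometric and algebraic multiplicity\<close>

text \<open>
  The first step of a Schur decomposition.  A basis that starts with an eigenvector \<open>x\<close> splits off
  one factor of the characteristic polynomial, and a repeated root \<open>k\<close> remains visible as an
  eigenvalue of the lower right block.
\<close>

lemma split_off_eigenvector:
  fixes A :: "'a :: conjugatable_ordered_field mat"
  assumes A: "A \<in> carrier_mat n n" and ev: "eigenvector A x k"
  obtains W W' A2 A3 where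
    "W \<in> carrier_mat n n" "W' \<in> carrier_mat n n" "W' * W = 1\<^sub>m n"
    "A2 \<in> carrier_mat 1 (n - 1)" "A3 \<in> carrier_mat (n - 1) (n - 1)"
    "A * W = W * four_block_mat (mat 1 1 (\<lambda>_. k)) A2 (0\<^sub>m (n - 1) 1) A3"
    "W *\<^sub>v unit_vec n 0 = x"
    "char_poly A = [:-k, 1:] * char_poly A3"
proof -
  let ?n1 = "n - 1"
  have x: "x \<in> carrier_vec n" and x0: "x \<noteq> 0\<^sub>v n" and eigen: "A *\<^sub>v x = k \<cdot>\<^sub>v x"
    using ev A unfolding eigenvector_def by auto
  have n: "n \<noteq> 0" using x x0 by (metis carrier_vecD eq_vecI index_zero_vec(2) not_less_zero)
  define b where "b = basis_completion x"
  define ws where "ws = gram_schmidt n b"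
  define W where "W = mat_of_cols n ws"
  define W' where "W' = corthogonal_inv W"
  define T where "T = W' * A * W"
  interpret cof_vec_space n "TYPE('a)" .
  from basis_completion[OF x x0, folded b_def]
  have dist_b: "distinct b" and indep: "\<not> lin_dep (set b)" and b: "set b \<subseteq> carrier_vec n"
    and hdb: "hd b = x" and len_b: "length b = n" by auto
  from hdb len_b n obtain vs where bv: "b = x # vs" by (cases b) auto
  from gram_schmidt_result[OF b dist_b indep refl, folded ws_def]
  have ws: "set ws \<subseteq> carrier_vec n" "corthogonal ws" "length ws = n"
    by (auto simp: len_b)
  from gram_schmidt_hd[OF x, of vs, folded bv] have hdws: "hd ws = x" unfolding ws_def .
  have orth_W: "corthogonal_mat W" using orthogonal_mat_of_cols ws unfolding W_def .
  have W: "W \<in> carrier_mat n n"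
    using ws unfolding W_def using mat_of_cols_carrier(1)[of n ws] by auto
  have W': "W' \<in> carrier_mat n n"
    unfolding W'_def corthogonal_inv_def using W by (auto simp: mat_of_rows_def)
  have W'W: "W' * W = 1\<^sub>m n"
    using corthogonal_inv_result[OF orth_W] W W' unfolding W'_def inverts_mat_def by auto
  have WW': "W * W' = 1\<^sub>m n" by (rule mat_mult_left_right_inverse[OF W' W W'W])
  have T: "T \<in> carrier_mat n n" using W W' A unfolding T_def by auto
  have WT: "W * T = A * W"
  proof -
    have "W * T = (W * W') * (A * W)"
      unfolding T_def using W W' A by (simp add: assoc_mult_mat[of _ n n _ n _ n])
    thus ?thesis using WW' A W by simp
  qed
  have "similar_mat_wit T A W' W"
    by (rule similar_mat_witI[of _ _ n]) (use W W' A T W'W WW' in \<open>auto simp: T_def\<close>)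
  hence cpT: "char_poly T = char_poly A"
    by (intro char_poly_similar) (auto simp: similar_mat_def)
  have col0: "col T 0 = vec n (\<lambda>i. if i = 0 then k else 0)"
    unfolding T_def W'_def W_def
    by (rule corthogonal_col_ev_0[OF A x x0 eigen n hdws ws])
  obtain A1 A2 A0 A3 where split: "split_block T 1 1 = (A1, A2, A0, A3)"
    by (cases "split_block T 1 1") auto
  from T n have "dim_row T = 1 + ?n1" "dim_col T = 1 + ?n1" by auto
  from split_block[OF split this] have A1: "A1 \<in> carrier_mat 1 1"
    and A2: "A2 \<in> carrier_mat 1 ?n1" and A0: "A0 \<in> carrier_mat ?n1 1"
    and A3: "A3 \<in> carrier_mat ?n1 ?n1"
    and block: "T = four_block_mat A1 A2 A0 A3" by auto
  have T0: "T $$ (i, 0) = (if i = 0 then k else 0)" if "i < n" for i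
    using arg_cong[OF col0, of "\<lambda>v. v $ i"] T n that by simp
  have A1_eq: "A1 = mat 1 1 (\<lambda>_. k)"
    using split[unfolded split_block_def Let_def] T0[of 0] T n by auto
  have A0_eq: "A0 = 0\<^sub>m ?n1 1"
    using split[unfolded split_block_def Let_def] T0 T by auto
  have "char_poly A1 = [:-k, 1:]"
    by (simp add: A1_eq char_poly_defs det_def sign_def)
  hence cp: "char_poly A = [:-k, 1:] * char_poly A3"
    using char_poly_four_block_zeros_col[OF A1 A2 A3] block A0_eq cpT by simp
  have We: "W *\<^sub>v unit_vec n 0 = x"
  proof -
    have "W *\<^sub>v unit_vec n 0 = col W 0" using W n col_mult2[of W n n "1\<^sub>m n" n 0] by simp
    also have "\<dots> = x" using hdws ws n unfolding W_def
      by (cases ws) auto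
    finally show ?thesis .
  qed
  show thesis
  proof (rule that[OF W W' W'W A2 A3 _ We cp])
    show "A * W = W * four_block_mat (mat 1 1 (\<lambda>_. k)) A2 (0\<^sub>m ?n1 1) A3"
      using WT block by (simp add: A1_eq A0_eq)
  qed
qed

text \<open>
  Geometric simplicity implies algebraic simplicity.  If \<open>k\<close> were a repeated root, splitting off \<open>x\<close>
  would leave a \<open>y\<close>, no multiple of \<open>x\<close>, with \<open>A y = c x + k y\<close>.  Pairing this with \<open>x\<close> and moving the
  symmetric \<open>A\<close> to the other side gives \<open>c (x \<bullet> x) = 0\<close>, so \<open>y\<close> would be a second eigenvector.
\<close>

lemma order_char_poly_symmetric:
  fixes A :: "real mat"
  assumes A: "A \<in> carrier_mat n n" "transpose_mat A = A"
    and ev: "eigenvector A x k"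
    and simple: "\<And>y. eigenvector A y k \<Longrightarrow> \<exists>a. y = a \<cdot>\<^sub>v x"
  shows "order k (char_poly A) = 1"
proof -
  let ?n1 = "n - 1"
  have x: "x \<in> carrier_vec n" and x0: "x \<noteq> 0\<^sub>v n" and eigen: "A *\<^sub>v x = k \<cdot>\<^sub>v x"
    using ev A unfolding eigenvector_def by auto
  have n: "n \<noteq> 0" using x x0 by (metis carrier_vecD eq_vecI index_zero_vec(2) not_less_zero)
  obtain W W' A2 A3 where W: "W \<in> carrier_mat n n" and W': "W' \<in> carrier_mat n n"
    and W'W: "W' * W = 1\<^sub>m n"
    and A2: "A2 \<in> carrier_mat 1 ?n1" and A3: "A3 \<in> carrier_mat ?n1 ?n1"
    and AW: "A * W = W * four_block_mat (mat 1 1 (\<lambda>_. k)) A2 (0\<^sub>m ?n1 1) A3"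
    and We: "W *\<^sub>v unit_vec n 0 = x"
    and cp: "char_poly A = [:-k, 1:] * char_poly A3"
    by (rule split_off_eigenvector[OF A(1) ev])
  define A1 A0 where "A1 = mat 1 1 (\<lambda>_::nat \<times> nat. k)" and "A0 = (0\<^sub>m ?n1 1 :: real mat)"
  define T where "T = four_block_mat A1 A2 A0 A3"
  have A1: "A1 \<in> carrier_mat 1 1" and A0: "A0 \<in> carrier_mat ?n1 1"
    by (simp_all add: A1_def A0_def)
  have T: "T \<in> carrier_mat n n"
    using four_block_carrier_mat[OF A1 A3, of A2 A0] n by (simp add: T_def)
  have WT: "W * T = A * W" by (simp add: AW T_def A1_def A0_def)
  have "poly (char_poly A3) k \<noteq> 0"
  proof
    assume "poly (char_poly A3) k = 0"
    hence "eigenvalue A3 k" by (simp add: eigenvalue_root_char_poly[OF A3])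
    then obtain v where v: "v \<in> carrier_vec ?n1" "v \<noteq> 0\<^sub>v ?n1" "A3 *\<^sub>v v = k \<cdot>\<^sub>v v"
      using A3 unfolding eigenvalue_def eigenvector_def by auto
    \<comment> \<open>\<open>c\<close> is the coefficient of \<open>x\<close> in \<open>A y\<close>; symmetry will force it to be \<open>0\<close>\<close>
    define u where "u = 0\<^sub>v 1 @\<^sub>v v"
    define c where "c = (A2 *\<^sub>v v) $ 0"
    define y where "y = W *\<^sub>v u"
    have u: "u \<in> carrier_vec n" using v(1) n by (intro carrier_vecI) (simp add: u_def)
    have y: "y \<in> carrier_vec n" using W u by (simp add: y_def)
    have Tu: "T *\<^sub>v u = c \<cdot>\<^sub>v unit_vec n 0 + k \<cdot>\<^sub>v u"
    proof -
      have "T *\<^sub>v u = (A1 *\<^sub>v 0\<^sub>v 1 + A2 *\<^sub>v v) @\<^sub>v (A0 *\<^sub>v 0\<^sub>v 1 + A3 *\<^sub>v v)"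
        unfolding T_def u_def by (rule four_block_mat_mult_vec[OF A1 A2 A0 A3 _ v(1)]) simp
      also have "\<dots> = (A2 *\<^sub>v v) @\<^sub>v (k \<cdot>\<^sub>v v)"
      proof -
        have "A1 *\<^sub>v 0\<^sub>v 1 = 0\<^sub>v 1" "A0 *\<^sub>v 0\<^sub>v 1 = 0\<^sub>v ?n1"
          using A1 A0 by (auto intro!: eq_vecI simp: scalar_prod_def)
        moreover have "A2 *\<^sub>v v \<in> carrier_vec 1" "A3 *\<^sub>v v \<in> carrier_vec ?n1"
          using A2 A3 v(1) by auto
        ultimately show ?thesis by (simp add: v(3))
      qed
      also have "\<dots> = c \<cdot>\<^sub>v unit_vec n 0 + k \<cdot>\<^sub>v u"
      proof (rule eq_vecI)
        show "dim_vec ((A2 *\<^sub>v v) @\<^sub>v (k \<cdot>\<^sub>v v)) = dim_vec (c \<cdot>\<^sub>v unit_vec n 0 + k \<cdot>\<^sub>v u)"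
          using A2 v(1) u n by simp
        fix i assume "i < dim_vec (c \<cdot>\<^sub>v unit_vec n 0 + k \<cdot>\<^sub>v u)"
        hence "i < n" using u by simp
        thus "((A2 *\<^sub>v v) @\<^sub>v (k \<cdot>\<^sub>v v)) $ i = (c \<cdot>\<^sub>v unit_vec n 0 + k \<cdot>\<^sub>v u) $ i"
          using A2 v(1) u n by (cases i) (simp_all add: u_def c_def)
      qed
      finally show ?thesis .
    qed
    have Ay: "A *\<^sub>v y = c \<cdot>\<^sub>v x + k \<cdot>\<^sub>v y"
    proof -
      have "A *\<^sub>v y = (W * T) *\<^sub>v u"
        unfolding WT y_def using A W u by simp
      also have "\<dots> = W *\<^sub>v (T *\<^sub>v u)" using W T u by simp
      also have "\<dots> = c \<cdot>\<^sub>v (W *\<^sub>v unit_vec n 0) + k \<cdot>\<^sub>v (W *\<^sub>v u)"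
        unfolding Tu using W u by (simp add: mult_add_distrib_mat_vec mult_mat_vec)
      finally show ?thesis by (simp add: We y_def)
    qed
    have xx: "x \<bullet> x \<noteq> 0"
      using real_scalar_prod_self(2)[OF x] x0 by simp
    have "x \<bullet> (A *\<^sub>v y) = c * (x \<bullet> x) + k * (x \<bullet> y)"
      unfolding Ay using x y by (simp add: scalar_prod_add_distrib[of _ n])
    moreover have "x \<bullet> (A *\<^sub>v y) = k * (x \<bullet> y)"
      using symmetric_scalar_prod[OF A x y] x y by (simp add: eigen comm_scalar_prod[of _ n])
    ultimately have "c = 0" using xx by simp
    hence "A *\<^sub>v y = k \<cdot>\<^sub>v y" using Ay x y by (auto intro!: eq_vecI)
    have W'y: "W' *\<^sub>v y = u"
    proof -
      have "W' *\<^sub>v y = (W' * W) *\<^sub>v u" unfolding y_def using W W' u by simp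
      thus ?thesis using W'W u by simp
    qed
    have W'x: "W' *\<^sub>v x = unit_vec n 0"
    proof -
      have "W' *\<^sub>v x = (W' * W) *\<^sub>v unit_vec n 0" unfolding We[symmetric] using W W' by simp
      thus ?thesis using W'W by simp
    qed
    have not_mult: "y \<noteq> a \<cdot>\<^sub>v x" for a
    proof
      assume "y = a \<cdot>\<^sub>v x"
      hence eq: "u = a \<cdot>\<^sub>v unit_vec n 0"
        using W' x by (simp add: W'y[symmetric] W'x[symmetric] mult_mat_vec)
      have "v $ i = 0" if "i < ?n1" for i
        using arg_cong[OF eq, of "\<lambda>w. w $ Suc i"] that v n by (simp add: u_def)
      with v show False by (metis carrier_vecD eq_vecI index_zero_vec)
    qed
    have "y \<noteq> 0\<^sub>v n" using not_mult[of 0] x by auto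
    hence "eigenvector A y k"
      using \<open>A *\<^sub>v y = k \<cdot>\<^sub>v y\<close> y A unfolding eigenvector_def by auto
    with simple not_mult show False by blast
  qed
  hence "order k (char_poly A3) = 0" by (rule order_0I)
  moreover have "char_poly A \<noteq> 0"
    using degree_monic_char_poly[OF A(1)] by auto
  moreover have "order k [:-k, 1:] = 1"
    using order_power_n_n[of k 1] by simp
  ultimately show ?thesis
    using order_mult[of "[:-k, 1:]" "char_poly A3" k] unfolding cp by linarith
qed

section \<open>Connected bipartite graphs\<close>

theorem theorem2p7:
  fixes G :: "('a, 'b) pre_digraph" and vs :: "'a list" and A :: "real mat"
  assumes "graph G" and "Digraph_Component.connected G" and "bipartite G"
    and "vertex_enumeration G vs"
    and "A \<in> schroedinger_operators G vs"
  shows "simple_eigenvalue A (Max (spectrum A))"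
proof -
  interpret graph G by fact
  define n where "n = length vs"
  define m where "m = Max (spectrum A)"
  define M where "M = char_matrix A m"
  have A: "A \<in> carrier_mat n n" "transpose_mat A = A"
    and off: "\<And>i j. i < n \<Longrightarrow> j < n \<Longrightarrow> i \<noteq> j \<Longrightarrow>
      (if (vs ! i, vs ! j) \<in> arcs_ends G then A $$ (i, j) < 0 else A $$ (i, j) = 0)"
    using assms(5) by (auto simp: schroedinger_operators_def n_def)
  have set_vs: "set vs = verts G" and dist: "distinct vs"
    using assms(4) by (auto simp: vertex_enumeration_def)
  have sc: "strongly_connected G"
    by (rule symmetric_connected_imp_strongly_connected[OF sym_arcs assms(2)])
  have n: "n > 0"
    using sc set_vs by (auto simp: strongly_connected_def n_def)
  obtain X Y where "X \<inter> Y = {}"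
    and "\<forall>(u, v) \<in> arcs_ends G. u \<in> X \<and> v \<in> Y \<or> u \<in> Y \<and> v \<in> X"
    using assms(3) unfolding bipartite_def by (elim exE conjE)
  hence sides: "u \<in> X \<longleftrightarrow> v \<notin> X" if "(u, v) \<in> arcs_ends G" for u v
    using that by (auto dest!: bspec)
  define \<epsilon> :: "nat \<Rightarrow> real" where "\<epsilon> i = (if vs ! i \<in> X then 1 else -1)" for i
  have M: "M \<in> carrier_mat n n" "transpose_mat M = M"
    using A transpose_char_matrix[OF A] by (auto simp: M_def)
  have M_off: "M $$ (i, j) = A $$ (i, j)" if "i < n" "j < n" "i \<noteq> j" for i j
    using A that by (simp add: M_def char_matrix_def)
  have neg: "y \<bullet> (M *\<^sub>v y) \<le> 0" if "y \<in> carrier_vec n" for y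
    using Max_spectrum_symmetric(2)[OF A n that] by (simp add: M_def m_def)
  have signs: "\<epsilon> i * \<epsilon> j * M $$ (i, j) \<ge> 0" if "i < n" "j < n" "i \<noteq> j" for i j
    using off[OF that] M_off[OF that] sides[of "vs ! i" "vs ! j"]
    by (auto simp: \<epsilon>_def split: if_splits)
  have zero_entry_imp_zero: "x = 0\<^sub>v n"
    if x: "x \<in> carrier_vec n" "M *\<^sub>v x = 0\<^sub>v n" and i: "i < n" "x $ i = 0" for x i
  proof -
    \<comment> \<open>the zeros of \<open>x\<close> spread along walks that start at the vertex of \<open>i\<close>\<close>
    have "\<forall>j<n. vs ! j = v \<longrightarrow> x $ j = 0" if "vs ! i \<rightarrow>\<^sup>*\<^bsub>G\<^esub> v" for v
      using that
    proof (induction rule: reachable_induct)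
      case base
      show ?case using i dist by (auto simp: n_def nth_eq_iff_index_eq)
    next
      case (step u v)
      have "u \<in> set vs" using adj_in_verts(1)[OF step(2)] by (simp add: set_vs)
      then obtain l where l: "l < n" "vs ! l = u" unfolding in_set_conv_nth n_def by blast
      show ?case
      proof (intro allI impI)
        fix j assume j: "j < n" "vs ! j = v"
        have "l \<noteq> j" using step(2) l j adj_not_same by auto
        hence "M $$ (l, j) \<noteq> 0"
          using off[OF l(1) j(1)] M_off[OF l(1) j(1)] step(2) l j by auto
        thus "x $ j = 0"
          using zero_entry_propagates[OF M neg _ signs x l(1) _ j(1)] step(3) l
          by (auto simp: \<epsilon>_def)
      qed
    qed
    hence "x $ j = 0" if "j < n" for j
      using sc set_vs i that unfolding strongly_connected_def n_def by (metis nth_mem)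
    thus ?thesis using x by (intro eq_vecI) auto
  qed
  have ev: "eigenvalue A m"
    using Max_spectrum_symmetric(1)[OF A n] by (simp add: m_def)
  then obtain x where x: "eigenvector A x m" unfolding eigenvalue_def by blast
  have ker: "eigenvector A y m \<longleftrightarrow> y \<in> carrier_vec n \<and> y \<noteq> 0\<^sub>v n \<and> M *\<^sub>v y = 0\<^sub>v n" for y
    unfolding eigenvector_char_matrix[OF A(1)] M_def by auto
  \<comment> \<open>subtracting the multiple of \<open>x\<close> that clears entry \<open>0\<close> of \<open>y\<close> clears all of \<open>y\<close>\<close>
  have "\<exists>a. y = a \<cdot>\<^sub>v x" if y: "eigenvector A y m" for y
  proof -
    have xc: "x \<in> carrier_vec n" "M *\<^sub>v x = 0\<^sub>v n" and yc: "y \<in> carrier_vec n" "M *\<^sub>v y = 0\<^sub>v n"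
      using x y by (auto simp: ker)
    have x0: "x $ 0 \<noteq> 0" using zero_entry_imp_zero[OF xc n] x by (auto simp: ker)
    define a where "a = y $ 0 / x $ 0"
    have "y - a \<cdot>\<^sub>v x = 0\<^sub>v n"
    proof (rule zero_entry_imp_zero[OF _ _ n])
      show "M *\<^sub>v (y - a \<cdot>\<^sub>v x) = 0\<^sub>v n"
        using M xc yc
        by (auto simp: mult_minus_distrib_mat_vec[of _ n n] mult_mat_vec[of _ n n] intro!: eq_vecI)
      show "(y - a \<cdot>\<^sub>v x) $ 0 = 0" using xc n x0 by (simp add: a_def)
    qed (use xc yc in auto)
    hence "(y - a \<cdot>\<^sub>v x) $ i = 0" if "i < n" for i using that by simp
    hence "y = a \<cdot>\<^sub>v x" using xc yc by (intro eq_vecI) auto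
    thus ?thesis ..
  qed
  from order_char_poly_symmetric[OF A x this] ev show ?thesis
    by (simp add: simple_eigenvalue_def m_def)
qed

end
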